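(* Let $n\geq 1$. Then (1) $\sum_{w\in \mathrm{PF}_n} \mathrm{sdes}(w) = (n-1)(n+1)^{n-2}$; (2) $\sum_{w\in \mathrm{PF}_n} \mathrm{sinv}(w) = \binom{n}{2}(n+1)^{n-2}$; (3) $\sum_{w\in \mathrm{PF}_n}\mathrm{bdes}(w)=\binom{n-1}{2}(n+1)^{n-2}$; (4) $\sum_{w\in \mathrm{PF}_n}\mathrm{binv}(w) = \frac{n(n-1)(n-2)(n+1)^{n-2}}{4}$.
   Context: Parking functions: $n$ cars enter a one-way street with spots $1,\dots,n$ in order; car $i$ has preferred spot $\alpha_i\in[n]$ and parks in spot $\alpha_i$ if free, otherwise in the next free spot after $\alpha_i$, if any. $\mathrm{PF}_n$ is the set of lists $\alpha\in[n]^n$ for which all cars park. For a word $w=w_1\cdots w_n$ of positive integers: $\mathrm{sdes}(w)$ (small descents) is the number of $i\in[n-1]$ with $w_i=w_{i+1}+1$; $\mathrm{sinv}(w)$ (small inversions) is the number of pairs $1\le i<j\le n$ with $w_i=w_j+1$; $\mathrm{bdes}(w)$ (big descents) is the number of $i\in[n-1]$ with $w_i>w_{i+1}+1$; $\mathrm{binv}(w)$ (big inversions) is the number of pairs $1\le i<j\le n$ with $w_i>w_j+1$. *)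

theory Defs
  imports Complex_Main
begin

text \<open>
  Cars are processed in list order on a street with spots \<open>1, ..., n\<close>, where \<open>occ\<close> is the set of
  spots already taken.  Each car takes the first free spot at or after its preference; the predicate
  holds iff no car runs off the end of the street.
\<close>

fun all_park :: "nat \<Rightarrow> nat set \<Rightarrow> nat list \<Rightarrow> bool" where
  "all_park n occ [] \<longleftrightarrow> True"
| "all_park n occ (a # as) \<longleftrightarrow>
     (\<exists>s. a \<le> s \<and> s \<le> n \<and> s \<notin> occ) \<and>
     all_park n (insert (LEAST s. a \<le> s \<and> s \<le> n \<and> s \<notin> occ) occ) as"

definition PF :: "nat \<Rightarrow> nat list set" where
  "PF n = {w. length w = n \<and> set w \<subseteq> {1..n} \<and> all_park n {} w}"

text \<open>List positions are 0-based, so position \<open>i\<close> of the list is the letter \<open>w\<^sub>i\<^sub>+\<^sub>1\<close> of the word.\<close>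

definition sdes :: "nat list \<Rightarrow> nat" where
  "sdes w = card {i. i + 1 < length w \<and> w ! i = w ! (i + 1) + 1}"

definition sinv :: "nat list \<Rightarrow> nat" where
  "sinv w = card {(i, j). i < j \<and> j < length w \<and> w ! i = w ! j + 1}"

definition bdes :: "nat list \<Rightarrow> nat" where
  "bdes w = card {i. i + 1 < length w \<and> w ! i > w ! (i + 1) + 1}"

definition binv :: "nat list \<Rightarrow> nat" where
  "binv w = card {(i, j). i < j \<and> j < length w \<and> w ! i > w ! j + 1}"

lemma finite_PF: "finite (PF n)"
  by (rule finite_subset[OF _ finite_lists_length_eq[of "{1..n}" n]]) (auto simp: PF_def)

end

theory Submission
  imports Defs "HOL-Library.Multiset"
begin

text \<open>
  The proof is Pollak's circle argument, applied to two letters at a time.  Put \<open>N = n + 1\<close> and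
  let the \<open>n\<close> cars park on a circular street with spots \<open>0, ..., n\<close> (residues modulo \<open>N\<close>, the
  spot \<open>0\<close> closing the circle after spot \<open>n\<close>).  Every car finds a spot and exactly one spot stays
  vacant.  A word of length \<open>n\<close> over \<open>{0..n}\<close> is a parking function iff the vacant spot is \<open>0\<close>
  (\<open>PF_eq_vacant_0\<close>): the first car that runs off the end of the straight street takes \<open>0\<close> on
  the circle, and a letter \<open>0\<close>, which no parking function has, also leads to \<open>0\<close> being filled.

  Adding \<open>1\<close> modulo \<open>N\<close> to all letters moves the vacant spot by one, and leaves the difference
  \<open>w\<^sub>i - w\<^sub>j\<close> modulo \<open>N\<close> unchanged.  So among the words with a prescribed difference \<open>d\<close> the vacant
  spot is equidistributed; and since adding \<open>1\<close> to the letter \<open>w\<^sub>i\<close> alone moves the difference by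
  one, the difference is itself equidistributed over all \<open>N ^ n\<close> words.  Hence for \<open>i \<noteq> j\<close> and each
  \<open>d\<close> there are exactly \<open>N ^ (n - 2)\<close> parking functions with
  \<open>w\<^sub>i - w\<^sub>j \<equiv> d\<close> (\<open>card_PF_difference\<close>).

  The letters of a parking function lie in \<open>{1..n}\<close>, so \<open>w\<^sub>i - w\<^sub>j \<equiv> 1\<close> modulo \<open>N\<close> means
  \<open>w\<^sub>i = w\<^sub>j + 1\<close>, because the only other candidate \<open>w\<^sub>i - w\<^sub>j = -n\<close> is out of range; this settles
  small descents and small inversions.  The final set of occupied spots does not depend on the
  order of the cars, so parking functions are closed under exchanging two letters, and
  \<open>w\<^sub>i > w\<^sub>j\<close> is as frequent as \<open>w\<^sub>i < w\<^sub>j\<close>.  Removing the ties (\<open>d = 0\<close>) from all \<open>N ^ (n - 1)\<close>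
  parking functions, halving, and removing the case \<open>d = 1\<close> leaves
  \<open>(n - 2) / 2 * N ^ (n - 2)\<close> parking functions with \<open>w\<^sub>i > w\<^sub>j + 1\<close>.  Each of the four sums is
  one of these two numbers times the number of positions or pairs of positions.
\<close>

section \<open>Parking on a circular street\<close>

definition next_free :: "nat \<Rightarrow> nat set \<Rightarrow> nat \<Rightarrow> nat" where
  "next_free N occ a = (a + (LEAST k. (a + k) mod N \<notin> occ)) mod N"

definition occupy :: "nat \<Rightarrow> nat \<Rightarrow> nat set \<Rightarrow> nat set" where
  "occupy N a occ = insert (next_free N occ a) occ"

definition circ_park :: "nat \<Rightarrow> nat set \<Rightarrow> nat list \<Rightarrow> nat set" where
  "circ_park N occ w = fold (occupy N) w occ"

lemma circ_park_simps [simp]: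
  "circ_park N occ [] = occ"
  "circ_park N occ (a # w) = circ_park N (occupy N a occ) w"
  by (simp_all add: circ_park_def)

lemma ex_free_offset:
  fixes a x N :: nat
  assumes "x < N" "x \<notin> occ"
  shows "\<exists>k. (a + k) mod N \<notin> occ"
proof
  have "a mod N \<le> N" using assms(1) by simp
  then have "(a + (x + (N - a mod N))) mod N = (a mod N + (x + (N - a mod N))) mod N"
    by (simp only: mod_add_left_eq)
  also have "a mod N + (x + (N - a mod N)) = x + N" using \<open>a mod N \<le> N\<close> by linarith
  also have "(x + N) mod N = x" using assms by simp
  finally show "(a + (x + (N - a mod N))) mod N \<notin> occ" using assms by simp
qed

lemma next_free_less: "0 < N \<Longrightarrow> next_free N occ a < N"
  by (simp add: next_free_def)

lemma next_free_notin:
  assumes "\<not> {..<N} \<subseteq> occ"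
  shows "next_free N occ a \<notin> occ"
proof -
  obtain x where "x < N" "x \<notin> occ" using assms by auto
  from LeastI_ex[OF ex_free_offset[OF this, of a]] show ?thesis by (simp add: next_free_def)
qed

lemma next_free_eqI:
  assumes "(a + K) mod N \<notin> occ" "\<And>k. k < K \<Longrightarrow> (a + k) mod N \<in> occ"
  shows "next_free N occ a = (a + K) mod N"
proof -
  have "(LEAST k. (a + k) mod N \<notin> occ) = K"
    using assms by (intro Least_equality) (auto simp: not_less[symmetric])
  then show ?thesis by (simp add: next_free_def)
qed

lemma next_freeE:
  assumes "\<not> {..<N} \<subseteq> occ"
  obtains K where "next_free N occ a = (a + K) mod N" "(a + K) mod N \<notin> occ"
    "\<And>k. k < K \<Longrightarrow> (a + k) mod N \<in> occ"
proof
  let ?K = "LEAST k. (a + k) mod N \<notin> occ"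
  show "next_free N occ a = (a + ?K) mod N" by (simp add: next_free_def)
  then show "(a + ?K) mod N \<notin> occ" using next_free_notin[OF assms, of a] by simp
  show "\<And>k. k < ?K \<Longrightarrow> (a + k) mod N \<in> occ" using not_less_Least by blast
qed

text \<open>On a full street the value of \<open>LEAST\<close> is arbitrary, but \<open>occupy\<close> then adds an element
  that is already present.\<close>

lemma occupy_full: "0 < N \<Longrightarrow> {..<N} \<subseteq> occ \<Longrightarrow> occupy N a occ = occ"
  using next_free_less by (auto simp: occupy_def)

lemma subset_circ_park: "occ \<subseteq> circ_park N occ w"
proof (induction w arbitrary: occ)
  case (Cons a w)
  from Cons.IH[of "occupy N a occ"] show ?case by (auto simp: occupy_def)
qed simp

text \<open>A preferred spot is taken at the end: it was occupied before, or the car that prefers it parks there.\<close>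

lemma set_subset_circ_park:
  assumes "set w \<subseteq> {..<N}"
  shows "set w \<subseteq> circ_park N occ w"
  using assms
proof (induction w arbitrary: occ)
  case (Cons a w)
  have "a \<in> occupy N a occ"
  proof (cases "a \<in> occ")
    case False
    then have "next_free N occ a = (a + 0) mod N"
      using Cons.prems by (intro next_free_eqI) auto
    then show ?thesis using Cons.prems by (simp add: occupy_def)
  qed (simp add: occupy_def)
  then show ?case using Cons subset_circ_park[of "occupy N a occ" N w] by auto
qed simp

lemma circ_park_card:
  assumes "0 < N" "occ \<subseteq> {..<N}" "card occ + length w \<le> N"
  shows "circ_park N occ w \<subseteq> {..<N} \<and> card (circ_park N occ w) = card occ + length w"
  using assms(2,3)
proof (induction w arbitrary: occ)
  case (Cons a w)
  have fin: "finite occ" using Cons.prems(1) finite_subset by blast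
  have "\<not> {..<N} \<subseteq> occ"
    using Cons.prems(2) card_mono[OF fin, of "{..<N}"] by auto
  then have "card (occupy N a occ) = Suc (card occ)"
    using fin by (simp add: occupy_def next_free_notin)
  moreover have "occupy N a occ \<subseteq> {..<N}"
    using Cons.prems(1) next_free_less[OF \<open>0 < N\<close>] by (simp add: occupy_def)
  ultimately show ?case using Cons.IH[of "occupy N a occ"] Cons.prems(2) by simp
qed simp

section \<open>Independence of the order of the cars\<close>

text \<open>A car may skip a run of occupied spots without changing where it parks.\<close>

lemma next_free_skip:
  assumes "\<not> {..<N} \<subseteq> occ" "\<And>k. k < K \<Longrightarrow> (a + k) mod N \<in> occ"
  shows "next_free N occ a = next_free N occ ((a + K) mod N)"
proof -
  obtain L where L: "next_free N occ a = (a + L) mod N" "(a + L) mod N \<notin> occ"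
    "\<And>k. k < L \<Longrightarrow> (a + k) mod N \<in> occ"
    using next_freeE[OF assms(1)] by metis
  have KL: "K \<le> L" using assms(2) L(2) by (meson not_less)
  have shift: "((a + K) mod N + k) mod N = (a + (K + k)) mod N" for k
    by (simp add: mod_add_left_eq add.assoc)
  have "next_free N occ ((a + K) mod N) = ((a + K) mod N + (L - K)) mod N"
  proof (rule next_free_eqI)
    show "((a + K) mod N + (L - K)) mod N \<notin> occ"
      unfolding shift using L(2) KL by simp
    fix k assume "k < L - K"
    then show "((a + K) mod N + k) mod N \<in> occ"
      unfolding shift using L(3)[of "K + k"] by simp
  qed
  then show ?thesis unfolding shift using L(1) KL by simp
qed

text \<open>If the two cars aim at different free spots they do not disturb each other.  If both aim
  at \<open>s\<close>, one of them takes \<open>s\<close> and the other goes on to the next free spot after \<open>s\<close>, whichever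
  comes first.\<close>

lemma occupy_commute:
  assumes "0 < N"
  shows "occupy N a (occupy N b occ) = occupy N b (occupy N a occ)"
proof (cases "{..<N} \<subseteq> occ")
  case True
  then show ?thesis using assms by (simp add: occupy_full)
next
  case free: False
  obtain K where K: "next_free N occ a = (a + K) mod N" "(a + K) mod N \<notin> occ"
    "\<And>k. k < K \<Longrightarrow> (a + k) mod N \<in> occ" using next_freeE[OF free] by metis
  obtain L where L: "next_free N occ b = (b + L) mod N" "(b + L) mod N \<notin> occ"
    "\<And>k. k < L \<Longrightarrow> (b + k) mod N \<in> occ" using next_freeE[OF free] by metis
  let ?s = "(a + K) mod N" and ?t = "(b + L) mod N"
  show ?thesis
  proof (cases "?s = ?t")
    case False
    have "next_free N (insert ?t occ) a = ?s"
      using K False by (intro next_free_eqI) auto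
    moreover have "next_free N (insert ?s occ) b = ?t"
      using L False by (intro next_free_eqI) auto
    ultimately show ?thesis using K(1) L(1) by (simp add: occupy_def insert_commute)
  next
    case True
    let ?occ = "insert ?s occ"
    have "occupy N a ?occ = occupy N b ?occ"
    proof (cases "{..<N} \<subseteq> ?occ")
      case True
      then show ?thesis using assms by (simp add: occupy_full)
    next
      case False
      have "next_free N ?occ a = next_free N ?occ ?s"
        using K(3) by (intro next_free_skip[OF False]) auto
      moreover have "next_free N ?occ b = next_free N ?occ ?t"
        using L(3) by (intro next_free_skip[OF False]) auto
      ultimately show ?thesis using True by (simp add: occupy_def)
    qed
    moreover have "occupy N a occ = ?occ" "occupy N b occ = ?occ"
      using K(1) L(1) True by (simp_all add: occupy_def)
    ultimately show ?thesis by simp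
  qed
qed

lemma circ_park_cong_mset:
  assumes "0 < N" "mset v = mset w"
  shows "circ_park N occ v = circ_park N occ w"
proof -
  have "fold (occupy N) v = fold (occupy N) w"
    using assms by (intro fold_multiset_equiv) (auto simp: fun_eq_iff occupy_commute)
  then show ?thesis by (simp add: circ_park_def)
qed

section \<open>The vacant spot and rotation\<close>

lemma inj_on_rotate: "inj_on (\<lambda>s. Suc s mod N) {..<N}"
  by (auto simp: inj_on_def mod_Suc split: if_splits)

lemma rotate_image: "0 < N \<Longrightarrow> (\<lambda>s. Suc s mod N) ` {..<N} = {..<N}"
  by (rule endo_inj_surj) (auto simp: inj_on_rotate)

lemma occupy_rotate:
  assumes "0 < N" "occ \<subseteq> {..<N}"
  shows "occupy N (Suc a mod N) ((\<lambda>s. Suc s mod N) ` occ) = (\<lambda>s. Suc s mod N) ` occupy N a occ"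
proof -
  have mod: "(Suc a mod N + k) mod N = Suc ((a + k) mod N) mod N" for k
    by (simp add: mod_add_left_eq mod_Suc_eq)
  have "(Suc a mod N + k) mod N \<in> (\<lambda>s. Suc s mod N) ` occ \<longleftrightarrow> (a + k) mod N \<in> occ" for k
    unfolding mod using assms by (intro inj_on_image_mem_iff[OF inj_on_rotate]) auto
  then show ?thesis by (simp add: occupy_def next_free_def mod)
qed

lemma circ_park_rotate:
  assumes "0 < N" "occ \<subseteq> {..<N}"
  shows "circ_park N ((\<lambda>s. Suc s mod N) ` occ) (map (\<lambda>s. Suc s mod N) w)
    = (\<lambda>s. Suc s mod N) ` circ_park N occ w"
  using assms(2)
proof (induction w arbitrary: occ)
  case (Cons a w)
  moreover have "occupy N a occ \<subseteq> {..<N}"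
    using Cons.prems next_free_less[OF \<open>0 < N\<close>] by (simp add: occupy_def)
  ultimately show ?case using occupy_rotate[OF \<open>0 < N\<close>] by simp
qed simp

definition words :: "nat \<Rightarrow> nat list set" where
  "words n = {w. set w \<subseteq> {..<Suc n} \<and> length w = n}"

definition vacant :: "nat \<Rightarrow> nat list \<Rightarrow> nat" where
  "vacant n w = the_elem ({..<Suc n} - circ_park (Suc n) {} w)"

lemma finite_words [simp]: "finite (words n)"
  unfolding words_def by (rule finite_lists_length_eq) simp

lemma card_words: "card (words n) = Suc n ^ n"
  unfolding words_def by (subst card_lists_length_eq) simp_all

lemma vacant_unique:
  assumes "w \<in> words n"
  shows "{..<Suc n} - circ_park (Suc n) {} w = {vacant n w}"
proof -
  have "circ_park (Suc n) {} w \<subseteq> {..<Suc n}" "card (circ_park (Suc n) {} w) = n"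
    using circ_park_card[of "Suc n" "{}" w] assms by (auto simp: words_def)
  then have "card ({..<Suc n} - circ_park (Suc n) {} w) = 1"
    by (subst card_Diff_subset) (auto intro: finite_subset)
  then show ?thesis unfolding vacant_def
    by (metis card_1_singletonE the_elem_eq)
qed

text \<open>Rotating all preferences rotates every parking step, hence the whole outcome.\<close>

lemma vacant_rotate:
  assumes "w \<in> words n"
  shows "vacant n (map (\<lambda>s. Suc s mod Suc n) w) = Suc (vacant n w) mod Suc n"
proof -
  let ?r = "\<lambda>s. Suc s mod Suc n" and ?C = "circ_park (Suc n) {} w"
  have sub: "?C \<subseteq> {..<Suc n}"
    using circ_park_card[of "Suc n" "{}" w] assms by (auto simp: words_def)
  have "circ_park (Suc n) {} (map ?r w) = ?r ` ?C"
    using circ_park_rotate[of "Suc n" "{}" w, OF zero_less_Suc empty_subsetI]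
    by (simp only: image_empty)
  then have "{..<Suc n} - circ_park (Suc n) {} (map ?r w) = ?r ` {..<Suc n} - ?r ` ?C"
    by (simp only: rotate_image[OF zero_less_Suc])
  also have "\<dots> = ?r ` ({..<Suc n} - ?C)"
    by (rule inj_on_image_set_diff[OF inj_on_rotate Diff_subset sub, symmetric])
  also have "\<dots> = {?r (vacant n w)}"
    by (simp only: vacant_unique[OF assms] image_insert image_empty)
  finally show ?thesis by (simp only: vacant_def[of n "map ?r w"] the_elem_eq)
qed

text \<open>As long as every car finds a spot on the straight street, it parks in the same spot on the
  circle.  The first car that does not find one drives through to the spot \<open>0\<close>.\<close>

lemma all_park_iff_circ_park:
  assumes "occ \<subseteq> {1..n}" "set w \<subseteq> {1..n}"
  shows "all_park n occ w \<longleftrightarrow> 0 \<notin> circ_park (Suc n) occ w"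
  using assms
proof (induction w arbitrary: occ)
  case Nil
  then show ?case by auto
next
  case (Cons a w)
  let ?P = "\<lambda>s. a \<le> s \<and> s \<le> n \<and> s \<notin> occ"
  have a: "1 \<le> a" "a \<le> n" using Cons.prems by auto
  show ?case
  proof (cases "\<exists>s. ?P s")
    case True
    define s where "s = (LEAST s. ?P s)"
    have s: "?P s" using LeastI_ex[OF True] unfolding s_def .
    have "next_free (Suc n) occ a = (a + (s - a)) mod Suc n"
    proof (rule next_free_eqI)
      show "(a + (s - a)) mod Suc n \<notin> occ" using s by simp
      fix k assume "k < s - a"
      then have "a + k < s" by simp
      then show "(a + k) mod Suc n \<in> occ"
        using not_less_Least[of "a + k" ?P] s unfolding s_def[symmetric] by simp
    qed
    then have "occupy (Suc n) a occ = insert s occ" using s by (simp add: occupy_def)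
    moreover have "insert s occ \<subseteq> {1..n}" using s a Cons.prems by auto
    ultimately show ?thesis
      using Cons.IH[of "insert s occ"] Cons.prems True by (simp add: s_def)
  next
    case False
    have "next_free (Suc n) occ a = (a + (Suc n - a)) mod Suc n"
    proof (rule next_free_eqI)
      show "(a + (Suc n - a)) mod Suc n \<notin> occ" using a Cons.prems by auto
      fix k assume "k < Suc n - a"
      then have "a + k \<le> n" by simp
      then show "(a + k) mod Suc n \<in> occ" using False by auto
    qed
    then have "0 \<in> occupy (Suc n) a occ" using a by (simp add: occupy_def)
    then show ?thesis using False subset_circ_park[of "occupy (Suc n) a occ" "Suc n" w] by auto
  qed
qed

lemma PF_eq_circ_park: "PF n = {w \<in> words n. 0 \<notin> circ_park (Suc n) {} w}"
proof (intro set_eqI iffI)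
  fix w assume "w \<in> PF n"
  then show "w \<in> {w \<in> words n. 0 \<notin> circ_park (Suc n) {} w}"
    using all_park_iff_circ_park[of "{}" n w] by (auto simp: PF_def words_def)
next
  fix w assume w: "w \<in> {w \<in> words n. 0 \<notin> circ_park (Suc n) {} w}"
  then have "0 \<notin> set w"
    using set_subset_circ_park[of w "Suc n" "{}"] by (auto simp: words_def)
  moreover have "set w \<subseteq> {0..n}" using w by (auto simp: words_def less_Suc_eq_le)
  ultimately have "set w \<subseteq> {0..n} - {0}" by blast
  also have "{0..n} - {0} = {1..n}" by auto
  finally have "set w \<subseteq> {1..n}" .
  then show "w \<in> PF n"
    using w all_park_iff_circ_park[of "{}" n w] by (auto simp: PF_def words_def)
qed

lemma PF_eq_vacant_0: "PF n = {w \<in> words n. vacant n w = 0}"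
proof -
  have "0 \<notin> circ_park (Suc n) {} w \<longleftrightarrow> vacant n w = 0" if "w \<in> words n" for w
  proof -
    have "0 \<notin> circ_park (Suc n) {} w \<longleftrightarrow> 0 \<in> {..<Suc n} - circ_park (Suc n) {} w" by simp
    then show ?thesis unfolding vacant_unique[OF that] by auto
  qed
  then show ?thesis unfolding PF_eq_circ_park by blast
qed

section \<open>Equidistribution of the vacant spot and of differences\<close>

text \<open>Going around the cycle with the injection \<open>g\<close>, no fibre of \<open>f\<close> is larger than the next one, so
  all \<open>N\<close> fibres have the same size.  This is used with the vacant spot as \<open>f\<close> and rotation of the
  word as \<open>g\<close>, and with the difference of two letters as \<open>f\<close> and the increment of one of them as
  \<open>g\<close>.\<close>

lemma card_fibre_cyclic:
  assumes "finite A" "g ` A \<subseteq> A" "inj_on g A"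
    and f: "\<And>x. x \<in> A \<Longrightarrow> f x < N" "\<And>x. x \<in> A \<Longrightarrow> f (g x) = Suc (f x) mod N"
    and "d < N"
  shows "N * card {x \<in> A. f x = d} = card A"
proof -
  define c where "c k = card {x \<in> A. f x = k}" for k
  have step: "c k \<le> c (Suc k mod N)" for k
    unfolding c_def using assms
    by (intro card_inj_on_le[of g]) (auto intro: inj_on_subset)
  have iter: "c k \<le> c ((k + m) mod N)" if "k < N" for k m
  proof (induction m)
    case (Suc m)
    then show ?case using step[of "(k + m) mod N"] by (simp add: mod_Suc_eq)
  qed (use that in simp)
  \<comment> \<open>\<open>N - k\<close> steps lead from \<open>k\<close> to \<open>0\<close>, and \<open>l\<close> more to \<open>l\<close>.\<close>
  have le: "c k \<le> c l" if "k < N" "l < N" for k l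
    using iter[OF that(1), of "N - k + l"] that by simp
  have "card A = card (\<Union>k<N. {x \<in> A. f x = k})"
    using f(1) by (intro arg_cong[of _ _ card]) auto
  also have "\<dots> = (\<Sum>k<N. c k)"
    unfolding c_def using \<open>finite A\<close> by (intro card_UN_disjoint) auto
  also have "\<dots> = (\<Sum>k<N. c d)"
    using le \<open>d < N\<close> by (intro sum.cong) (auto intro: antisym)
  finally show ?thesis by (simp add: c_def)
qed

lemma rotate_words: "w \<in> words n \<Longrightarrow> map (\<lambda>s. Suc s mod Suc n) w \<in> words n"
  by (auto simp: words_def)

lemma inj_on_rotate_words: "inj_on (map (\<lambda>s. Suc s mod Suc n)) (words n)"
proof (rule inj_on_mapI, rule inj_on_subset[OF inj_on_rotate])
  show "\<Union> (set ` words n) \<subseteq> {..<Suc n}" by (auto simp: words_def)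
qed

lemma vacant_less: "w \<in> words n \<Longrightarrow> vacant n w < Suc n"
  using vacant_unique by auto

text \<open>Pollak's argument: a rotation orbit contains each vacant spot once, so one word in \<open>n + 1\<close> is a
  parking function, also within any rotation-invariant set of words.\<close>

lemma card_PF_rotation_invariant:
  assumes "\<And>w. w \<in> words n \<Longrightarrow> Q w \<Longrightarrow> Q (map (\<lambda>s. Suc s mod Suc n) w)"
  shows "Suc n * card {w \<in> PF n. Q w} = card {w \<in> words n. Q w}"
proof -
  have "Suc n * card {w \<in> {w \<in> words n. Q w}. vacant n w = 0} = card {w \<in> words n. Q w}"
    by (rule card_fibre_cyclic[where g = "map (\<lambda>s. Suc s mod Suc n)"])
      (use assms in \<open>auto simp: rotate_words vacant_less vacant_rotate
         intro: inj_on_subset[OF inj_on_rotate_words]\<close>)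
  moreover have "{w \<in> {w \<in> words n. Q w}. vacant n w = 0} = {w \<in> PF n. Q w}"
    by (auto simp: PF_eq_vacant_0)
  ultimately show ?thesis by simp
qed

text \<open>The difference of two letters modulo \<open>n + 1\<close>; adding the modulus before subtracting avoids
  truncation at \<open>0\<close>.\<close>

definition cyc_diff :: "nat \<Rightarrow> nat \<Rightarrow> nat \<Rightarrow> nat list \<Rightarrow> nat" where
  "cyc_diff n i j w = (w ! i + (Suc n - w ! j)) mod Suc n"

lemma words_nth: "w \<in> words n \<Longrightarrow> i < n \<Longrightarrow> w ! i < Suc n"
  unfolding words_def using nth_mem by blast

lemma cyc_diff_rotate:
  assumes "w \<in> words n" "i < n" "j < n"
  shows "cyc_diff n i j (map (\<lambda>s. Suc s mod Suc n) w) = cyc_diff n i j w"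
proof -
  have shift: "(Suc x mod Suc n + (Suc n - Suc y mod Suc n)) mod Suc n
      = (x + (Suc n - y)) mod Suc n" if "x < Suc n" "y < Suc n" for x y
  proof (cases "y = n")
    case True
    then have "(Suc x mod Suc n + (Suc n - Suc y mod Suc n)) mod Suc n = Suc x mod Suc n"
      by (simp del: add_Suc_right)
    then show ?thesis using True by simp
  next
    case False
    then have "Suc y mod Suc n = Suc y" using that by simp
    then have "(Suc x mod Suc n + (Suc n - Suc y mod Suc n)) mod Suc n
        = (Suc x + (n - y)) mod Suc n"
      by (simp add: mod_add_left_eq del: add_Suc)
    then show ?thesis using that by (simp add: Suc_diff_le)
  qed
  have "map (\<lambda>s. Suc s mod Suc n) w ! k = Suc (w ! k) mod Suc n" if "k < n" for k
    using assms(1) that by (simp add: words_def)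
  note nth = this[OF assms(2)] this[OF assms(3)]
  show ?thesis
    unfolding cyc_diff_def nth by (intro shift words_nth assms)
qed

lemma card_words_cyc_diff:
  assumes "i < n" "j < n" "i \<noteq> j" "d \<le> n"
  shows "Suc n * card {w \<in> words n. cyc_diff n i j w = d} = Suc n ^ n"
proof -
  let ?g = "\<lambda>w. w[i := Suc (w ! i) mod Suc n]"
  have "Suc n * card {w \<in> words n. cyc_diff n i j w = d} = card (words n)"
  proof (rule card_fibre_cyclic[where g = ?g])
    show "?g ` words n \<subseteq> words n"
      by (auto simp: words_def dest!: set_update_subset_insert[THEN subsetD])
    show "inj_on ?g (words n)"
    proof (rule inj_onI)
      fix v w assume vw: "v \<in> words n" "w \<in> words n" "?g v = ?g w"
      have len: "length v = n" "length w = n" using vw by (auto simp: words_def)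
      show "v = w"
      proof (rule nth_equalityI)
        fix k assume "k < length v"
        have eq: "?g v ! k = ?g w ! k" using vw(3) by simp
        show "v ! k = w ! k"
        proof (cases "k = i")
          case True
          then have "Suc (v ! i) mod Suc n = Suc (w ! i) mod Suc n"
            using eq len assms(1) by simp
          then show ?thesis
            using inj_onD[OF inj_on_rotate] words_nth[OF vw(1) assms(1)]
              words_nth[OF vw(2) assms(1)] True by blast
        qed (use eq in simp)
      qed (simp add: len)
    qed
    fix w assume w: "w \<in> words n"
    then have "length w = n" by (simp add: words_def)
    then show "cyc_diff n i j (?g w) = Suc (cyc_diff n i j w) mod Suc n"
      using assms by (simp add: cyc_diff_def mod_add_left_eq mod_Suc_eq)
    show "cyc_diff n i j w < Suc n" by (simp add: cyc_diff_def)
  qed (use assms in auto)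
  then show ?thesis by (simp add: card_words)
qed

section \<open>Parking functions with prescribed relation between two letters\<close>

lemma PF_nth: "w \<in> PF n \<Longrightarrow> i < n \<Longrightarrow> w ! i \<in> {1..n}"
  using nth_mem[of i w] unfolding PF_def by blast

lemma card_PF: "Suc n * card (PF n) = Suc n ^ n"
  using card_PF_rotation_invariant[of n "\<lambda>_. True"] by (simp add: card_words)

lemma power_factor_two: "2 \<le> n \<Longrightarrow> x ^ n = x * (x * x ^ (n - 2))" for x :: nat
proof -
  assume "2 \<le> n"
  then obtain k where "n = 2 + k" using le_Suc_ex by blast
  then show ?thesis by (simp add: power2_eq_square)
qed

lemma card_PF_difference:
  assumes "i < n" "j < n" "i \<noteq> j" "d \<le> n"
  shows "card {w \<in> PF n. cyc_diff n i j w = d} = Suc n ^ (n - 2)"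
proof -
  have "Suc n * (Suc n * card {w \<in> PF n. cyc_diff n i j w = d}) = Suc n ^ n"
    using card_PF_rotation_invariant[of n "\<lambda>w. cyc_diff n i j w = d"]
      card_words_cyc_diff[OF assms] cyc_diff_rotate assms by simp
  also have "\<dots> = Suc n * (Suc n * Suc n ^ (n - 2))"
    using assms by (intro power_factor_two) simp
  finally show ?thesis by (simp del: mult_Suc power_Suc)
qed

text \<open>Modulo \<open>n + 1\<close> a difference \<open>d\<close> could also come from \<open>w\<^sub>i - w\<^sub>j = d - (n + 1)\<close>.  For
  \<open>d \<le> 1\<close> this is at most \<open>-n\<close>, too small for letters in \<open>{1..n}\<close>.\<close>

lemma cyc_diff_eq_iff:
  assumes "w \<in> PF n" "i < n" "j < n" "d \<le> 1"
  shows "cyc_diff n i j w = d \<longleftrightarrow> w ! i = w ! j + d"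
proof -
  have r: "1 \<le> w ! i" "w ! i \<le> n" "1 \<le> w ! j" "w ! j \<le> n"
    using PF_nth[OF assms(1)] assms(2,3) by auto
  show ?thesis
  proof (cases "w ! j \<le> w ! i")
    case True
    have "w ! i + (Suc n - w ! j) = (w ! i - w ! j) + Suc n" using True r by linarith
    then have "cyc_diff n i j w = (w ! i - w ! j) mod Suc n"
      by (simp only: cyc_diff_def mod_add_self2)
    also have "\<dots> = w ! i - w ! j" using r by (intro mod_less) linarith
    finally show ?thesis using True by linarith
  next
    case False
    then have "cyc_diff n i j w = w ! i + (Suc n - w ! j)"
      unfolding cyc_diff_def using r by (intro mod_less) linarith
    then show ?thesis using False r assms(4) by linarith
  qed
qed

lemma card_PF_plus:
  assumes "i < n" "j < n" "i \<noteq> j" "d \<le> 1"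
  shows "card {w \<in> PF n. w ! i = w ! j + d} = Suc n ^ (n - 2)"
proof -
  have "{w \<in> PF n. w ! i = w ! j + d} = {w \<in> PF n. cyc_diff n i j w = d}"
    using cyc_diff_eq_iff assms by blast
  then show ?thesis using card_PF_difference[of i n j d] assms by simp
qed

text \<open>Exchanging two cars does not change which spots they fill on the circle, so \<open>0\<close> stays vacant.\<close>

lemma PF_swap:
  assumes "w \<in> PF n" "i < n" "j < n"
  shows "w[i := w ! j, j := w ! i] \<in> PF n"
proof -
  have len: "length w = n" using assms by (simp add: PF_def)
  have m: "mset (w[i := w ! j, j := w ! i]) = mset w"
    using assms len by (intro mset_swap) auto
  have "set (w[i := w ! j, j := w ! i]) = set w" using m by (metis set_mset_mset)
  then show ?thesis
    using assms(1) circ_park_cong_mset[OF _ m, of "Suc n" "{}"]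
    by (simp add: PF_eq_circ_park words_def)
qed

lemma card_PF_greater_le:
  assumes "i < n" "j < n" "i \<noteq> j"
  shows "card {w \<in> PF n. w ! j < w ! i} \<le> card {w \<in> PF n. w ! i < w ! j}"
proof -
  let ?swap = "\<lambda>w. w[i := w ! j, j := w ! i]"
  show ?thesis
  proof (rule card_inj_on_le[of ?swap])
    show "inj_on ?swap {w \<in> PF n. w ! j < w ! i}"
    proof (rule inj_on_inverseI[where g = ?swap])
      fix w assume "w \<in> {w \<in> PF n. w ! j < w ! i}"
      then have "length w = n" by (simp add: PF_def)
      then show "?swap (?swap w) = w"
        using assms by (intro nth_equalityI) (auto simp: nth_list_update)
    qed
    show "?swap ` {w \<in> PF n. w ! j < w ! i} \<subseteq> {w \<in> PF n. w ! i < w ! j}"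
    proof safe
      fix w assume w: "w \<in> PF n" "w ! j < w ! i"
      then show "?swap w \<in> PF n" using PF_swap assms by blast
      have "length w = n" using w by (simp add: PF_def)
      then show "?swap w ! i < ?swap w ! j" using w assms by simp
    qed
    show "finite {w \<in> PF n. w ! i < w ! j}" using finite_PF by simp
  qed
qed

text \<open>Of the \<open>(n + 1) * p\<close> parking functions, where \<open>p = (n + 1) ^ (n - 2)\<close>, \<open>p\<close> have a tie.
  By symmetry half of the remaining \<open>n * p\<close> have \<open>w\<^sub>i > w\<^sub>j\<close>, and in \<open>p\<close> of these the
  excess is exactly \<open>1\<close>.\<close>

lemma card_PF_big:
  assumes "i < n" "j < n" "i \<noteq> j"
  shows "2 * card {w \<in> PF n. w ! i > w ! j + 1} = (n - 2) * Suc n ^ (n - 2)"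
proof -
  define p where "p = Suc n ^ (n - 2)"
  define Gt Eq Lt Big Small where sets:
    "Gt = {w \<in> PF n. w ! j < w ! i}" "Eq = {w \<in> PF n. w ! i = w ! j}"
    "Lt = {w \<in> PF n. w ! i < w ! j}" "Big = {w \<in> PF n. w ! i > w ! j + 1}"
    "Small = {w \<in> PF n. w ! i = w ! j + 1}"
  have n: "2 \<le> n" using assms by linarith
  have fin: "finite Gt" "finite Eq" "finite Lt" "finite Big" "finite Small"
    unfolding sets using finite_PF by simp_all
  have "Suc n * card (PF n) = Suc n * (Suc n * p)"
    using card_PF[of n] power_factor_two[OF n, of "Suc n"] by (simp only: p_def)
  then have "card (PF n) = Suc n * p" by (simp del: mult_Suc)
  moreover have "card (PF n) = card Gt + (card Eq + card Lt)"
  proof -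
    have "PF n = Gt \<union> (Eq \<union> Lt)" unfolding sets by auto
    then have "card (PF n) = card (Gt \<union> (Eq \<union> Lt))" by (rule arg_cong)
    also have "\<dots> = card Gt + card (Eq \<union> Lt)"
      by (rule card_Un_disjoint) (use fin in \<open>auto simp: sets\<close>)
    also have "card (Eq \<union> Lt) = card Eq + card Lt"
      by (rule card_Un_disjoint) (use fin in \<open>auto simp: sets\<close>)
    finally show ?thesis .
  qed
  moreover have "card Gt = card Lt"
    unfolding sets
    using card_PF_greater_le[OF assms] card_PF_greater_le[OF assms(2,1) assms(3)[symmetric]]
    by (rule antisym)
  moreover have "card Gt = card Big + card Small"
  proof -
    have "Gt = Big \<union> Small" unfolding sets by auto
    then have "card Gt = card (Big \<union> Small)" by (rule arg_cong)
    also have "\<dots> = card Big + card Small"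
      by (rule card_Un_disjoint) (use fin in \<open>auto simp: sets\<close>)
    finally show ?thesis .
  qed
  moreover have "card Small = p" "card Eq = p"
    using card_PF_plus[OF assms, of 1] card_PF_plus[OF assms, of 0] by (simp_all add: sets p_def)
  moreover have "Suc n * p = (n - 2) * p + 3 * p"
  proof -
    have "Suc n = n - 2 + 3" using n by simp
    then show ?thesis by (simp only: add_mult_distrib)
  qed
  ultimately have "2 * card Big = (n - 2) * p" by linarith
  then show ?thesis by (simp only: sets p_def)
qed

section \<open>Summing over positions\<close>

lemma sum_card_const_fibres:
  assumes "finite A" "finite X" "\<And>x. x \<in> X \<Longrightarrow> real (card {w \<in> A. R w x}) = c"
  shows "real (\<Sum>w\<in>A. card {x \<in> X. R w x}) = real (card X) * c"
proof -
  have "(\<Sum>w\<in>A. card {x \<in> X. R w x}) = (\<Sum>x\<in>X. card {w \<in> A. R w x})"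
    by (rule sum_multicount_gen) (use assms in auto)
  then show ?thesis using assms(3) by simp
qed

lemma card_pairs_less: "card {(i, j). i < j \<and> j < n} = n choose 2"
proof -
  have "{(i, j). i < j \<and> j < n} = prod.swap ` (SIGMA j:{..<n}. {..<j})"
    by (auto simp: image_iff)
  then have "card {(i, j). i < j \<and> j < n} = card (SIGMA j:{..<n}. {..<j})"
    by (simp add: card_image)
  also have "\<dots> = \<Sum>{0..<n}" by (simp add: lessThan_atLeast0)
  also have "\<dots> = n choose 2" by (simp add: Sum_Ico_nat choose_two)
  finally show ?thesis .
qed

lemma real_choose_two: "real (n choose 2) = real n * (real n - 1) / 2"
  by (cases n) (simp_all add: choose_two real_of_nat_div algebra_simps)

theorem proposition5p18:
  fixes n :: nat
  assumes "n \<ge> 1"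
  shows "real (\<Sum>w\<in>PF n. sdes w) = (real n - 1) * (real n + 1) powi (int n - 2) \<and>
     real (\<Sum>w\<in>PF n. sinv w) = real (n choose 2) * (real n + 1) powi (int n - 2) \<and>
     real (\<Sum>w\<in>PF n. bdes w) = real ((n - 1) choose 2) * (real n + 1) powi (int n - 2) \<and>
     real (\<Sum>w\<in>PF n. binv w) =
       real n * (real n - 1) * (real n - 2) * (real n + 1) powi (int n - 2) / 4"
proof -
  define p where "p = (real n + 1) powi (int n - 2)"
  let ?D = "{i. i + 1 < n}" and ?I = "{(i, j). i < j \<and> j < n}"
  \<comment> \<open>Two distinct positions force \<open>n \<ge> 2\<close>, where the integer power is a natural one; for \<open>n = 1\<close>
    the exponent is negative, but there are no positions to count.\<close>
  have p: "real (Suc n ^ (n - 2)) = p" if "i < j" "j < n" for i j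
  proof -
    have "2 \<le> n" using that by linarith
    then have "int n - 2 = int (n - 2)" by (simp add: of_nat_diff)
    then have "p = (real n + 1) ^ (n - 2)" unfolding p_def by (simp only: power_int_of_nat)
    also have "real n + 1 = real (Suc n)" by simp
    finally show ?thesis by (simp only: of_nat_power)
  qed
  have small: "real (card {w \<in> PF n. w ! i = w ! j + 1}) = p" if "i < j" "j < n" for i j
    using card_PF_plus[of i n j 1] p[OF that] that by simp
  have big: "real (card {w \<in> PF n. w ! i > w ! j + 1}) = (real n - 2) / 2 * p"
    if "i < j" "j < n" for i j
  proof -
    have "2 * real (card {w \<in> PF n. w ! i > w ! j + 1}) = real (n - 2) * real (Suc n ^ (n - 2))"
      
      using arg_cong[OF card_PF_big[of i n j], of real] that
      by (simp only: of_nat_mult of_nat_numeral)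
    moreover have "2 \<le> n" using that by linarith
    then have "real (n - 2) = real n - 2" by (simp add: of_nat_diff)
    ultimately have "2 * real (card {w \<in> PF n. w ! i > w ! j + 1}) = (real n - 2) * p"
      by (simp only: p[OF that])
    then show ?thesis by linarith
  qed
  have len: "length w = n" if "w \<in> PF n" for w using that by (simp add: PF_def)
  have D: "?D = {..<n - 1}" by auto
  have finD: "finite ?D" unfolding D by simp
  have finI: "finite ?I" by (rule finite_subset[of _ "{..<n} \<times> {..<n}"]) auto
  have cardD: "real (card ?D) = real n - 1" unfolding D using assms by (simp add: of_nat_diff)
  have "real (\<Sum>w\<in>PF n. sdes w)
      = real (\<Sum>w\<in>PF n. card {i \<in> ?D. w ! i = w ! (i + 1) + 1})"
    by (intro arg_cong[of _ _ real] sum.cong) (auto simp: sdes_def len)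
  also have "\<dots> = real (card ?D) * p"
    by (rule sum_card_const_fibres[OF finite_PF finD]) (simp add: small[simplified])
  finally have 1: "real (\<Sum>w\<in>PF n. sdes w) = (real n - 1) * p" by (simp only: cardD)
  have "real (\<Sum>w\<in>PF n. bdes w)
      = real (\<Sum>w\<in>PF n. card {i \<in> ?D. w ! i > w ! (i + 1) + 1})"
    by (intro arg_cong[of _ _ real] sum.cong) (auto simp: bdes_def len)
  also have "\<dots> = real (card ?D) * ((real n - 2) / 2 * p)"
    by (rule sum_card_const_fibres[OF finite_PF finD]) (use big in auto)
  also have "\<dots> = real ((n - 1) choose 2) * p"
    using assms by (simp only: cardD real_choose_two) (simp add: of_nat_diff)
  finally have 3: "real (\<Sum>w\<in>PF n. bdes w) = real ((n - 1) choose 2) * p" .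
  have "real (\<Sum>w\<in>PF n. sinv w)
      = real (\<Sum>w\<in>PF n. card {x \<in> ?I. w ! fst x = w ! snd x + 1})"
    by (intro arg_cong[of _ _ real] sum.cong) (auto simp: sinv_def len intro!: arg_cong[of _ _ card])
  also have "\<dots> = real (card ?I) * p"
    by (rule sum_card_const_fibres[OF finite_PF finI]) (use small in auto)
  finally have 2: "real (\<Sum>w\<in>PF n. sinv w) = real (n choose 2) * p"
    by (simp only: card_pairs_less)
  have "real (\<Sum>w\<in>PF n. binv w)
      = real (\<Sum>w\<in>PF n. card {x \<in> ?I. w ! fst x > w ! snd x + 1})"
    by (intro arg_cong[of _ _ real] sum.cong) (auto simp: binv_def len intro!: arg_cong[of _ _ card])
  also have "\<dots> = real (card ?I) * ((real n - 2) / 2 * p)"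
    by (rule sum_card_const_fibres[OF finite_PF finI]) (use big in auto)
  also have "\<dots> = real n * (real n - 1) * (real n - 2) * p / 4"
    by (simp only: card_pairs_less real_choose_two) simp
  finally have 4: "real (\<Sum>w\<in>PF n. binv w) = real n * (real n - 1) * (real n - 2) * p / 4" .
  show ?thesis using 1 2 3 4 unfolding p_def by blast
qed

end
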